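(* Let $\alpha\in\mathbb{R}^{d_1}_{++}$ with $\sum_{i\in[d_1]}\alpha_i=1$ and let $(p,r)$, with $p\in\mathbb{R}^{d_1}$ and $0\ne r\in\mathbb{R}^{d_2}$, be in the interior of $\mathcal{K}_{\mathrm{gpow}(\alpha,d_1,d_2)}$. The corresponding primal conjugate gradient $g_{(p,r)}=(g_p,g_r)$ (of the dual barrier $f^*_{\mathrm{gpow}}$) is given by $$g_{p_i}=-\frac{(1+\alpha_i)+\alpha_i\,g_{\|r\|}\|r\|}{p_i}\quad\forall i\in[d_1],\qquad g_r=\frac{g_{\|r\|}\cdot r}{\|r\|},$$ where $g_{\|r\|}$ is the root on $x>0$ of $$h(x)=\sum_{i\in[d_1]}2\alpha_i\ln\Big(\|r\|\,x+\frac{1+\alpha_i}{\alpha_i}\Big)-\ln\Big(\frac{2x}{\|r\|}+x^2\Big)-\sum_{i\in[d_1]}2\alpha_i\ln(p_i).$$ The root of $h$ is computable by the one-dimensional Newton–Raphson method, which converges quadratically when started from $$x_0=-\frac1{\|r\|}+\frac{\psi\|r\|+\sqrt{\chi\big(\frac{\chi}{\|r\|^2}+\psi^2-1\big)}}{\chi-\|r\|^2},\qquad \chi=\prod_{i\in[d_1]}p_i^{2\alpha_i},\quad \psi=\frac{1}{\sum_{i\in[d_1]}\alpha_i^2}.$$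
   Context: $[d]=\{1,\dots,d\}$; $\mathbb{R}^d_+$, $\mathbb{R}^d_{++}$ are the vectors with nonnegative, resp. positive, entries; $\|\cdot\|$ is the Euclidean norm. Cones: $\mathcal{K}_{\mathrm{gpow}(\alpha,d_1,d_2)}=\{(u,w)\in\mathbb{R}^{d_1}_+\times\mathbb{R}^{d_2}:\prod_{i\in[d_1]}u_i^{\alpha_i}\ge\|w\|\}$, with dual $\mathcal{K}^*_{\mathrm{gpow}(\alpha,d_1,d_2)}=\{(u,w)\in\mathbb{R}^{d_1}_+\times\mathbb{R}^{d_2}:\prod_{i\in[d_1]}(u_i/\alpha_i)^{\alpha_i}\ge\|w\|\}$. Dual barrier, on $\mathrm{int}\,\mathcal{K}^*_{\mathrm{gpow}(\alpha,d_1,d_2)}$: $f^*_{\mathrm{gpow}}(u,w)=-\ln\big(\prod_{i\in[d_1]}(u_i/\alpha_i)^{2\alpha_i}-\|w\|^2\big)-\sum_{i\in[d_1]}(1-\alpha_i)\ln(u_i/\alpha_i)$, with gradient $g^*=\nabla f^*_{\mathrm{gpow}}$. Primal conjugate gradient: for $s$ in the interior of the primal cone $\mathcal{K}$, $g_s=-\arg\max_{y\in\mathrm{int}\,\mathcal{K}^*}\{-\langle s,y\rangle-f^*(y)\}$; equivalently $g_s$ is the vector with $-g_s\in\mathrm{int}\,\mathcal{K}^*$ and $-g^*(-g_s)=s$. *)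

theory Defs
  imports "HOL-Analysis.Analysis"
begin

definition gpow_cone :: "real ^ 'm \<Rightarrow> ((real ^ 'm) \<times> (real ^ 'n)) set" where
  "gpow_cone \<alpha> = {(u, w). (\<forall>i. 0 \<le> u $ i) \<and>
     (\<Prod>i\<in>UNIV. (u $ i) powr (\<alpha> $ i)) \<ge> norm w}"

definition gpow_dual_cone :: "real ^ 'm \<Rightarrow> ((real ^ 'm) \<times> (real ^ 'n)) set" where
  "gpow_dual_cone \<alpha> = {(u, w). (\<forall>i. 0 \<le> u $ i) \<and>
     (\<Prod>i\<in>UNIV. (u $ i / \<alpha> $ i) powr (\<alpha> $ i)) \<ge> norm w}"

definition gpow_dual_barrier :: "real ^ 'm \<Rightarrow> (real ^ 'm) \<times> (real ^ 'n) \<Rightarrow> real" where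
  "gpow_dual_barrier \<alpha> = (\<lambda>(u, w).
     - ln ((\<Prod>i\<in>UNIV. (u $ i / \<alpha> $ i) powr (2 * \<alpha> $ i)) - (norm w)\<^sup>2)
     - (\<Sum>i\<in>UNIV. (1 - \<alpha> $ i) * ln (u $ i / \<alpha> $ i)))"

text \<open>
  \<open>g\<close> is a primal conjugate gradient at \<open>s\<close> for the barrier \<open>f\<close> of the dual cone \<open>K\<close> iff
  \<open>- g\<close> maximizes \<open>- \<langle>s, y\<rangle> - f y\<close> over the interior of \<open>K\<close>.  A predicate is used so that
  existence and uniqueness of the maximizer have to be asserted, not presupposed.
\<close>

definition is_conj_gradient ::
    "('a::real_inner \<Rightarrow> real) \<Rightarrow> 'a set \<Rightarrow> 'a \<Rightarrow> 'a \<Rightarrow> bool" where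
  "is_conj_gradient f K s g \<longleftrightarrow>
     is_arg_max (\<lambda>y. - (s \<bullet> y) - f y) (\<lambda>y. y \<in> interior K) (- g)"

definition gpow_h :: "real ^ 'm \<Rightarrow> real ^ 'm \<Rightarrow> real ^ 'n \<Rightarrow> real \<Rightarrow> real" where
  "gpow_h \<alpha> p r x =
     (\<Sum>i\<in>UNIV. 2 * \<alpha> $ i * ln (norm r * x + (1 + \<alpha> $ i) / \<alpha> $ i))
     - ln (2 * x / norm r + x\<^sup>2)
     - (\<Sum>i\<in>UNIV. 2 * \<alpha> $ i * ln (p $ i))"

definition gpow_chi :: "real ^ 'm \<Rightarrow> real ^ 'm \<Rightarrow> real" where
  "gpow_chi \<alpha> p = (\<Prod>i\<in>UNIV. (p $ i) powr (2 * \<alpha> $ i))"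

definition gpow_psi :: "real ^ 'm \<Rightarrow> real" where
  "gpow_psi \<alpha> = 1 / (\<Sum>i\<in>UNIV. (\<alpha> $ i)\<^sup>2)"

definition gpow_x0 :: "real ^ 'm \<Rightarrow> real ^ 'm \<Rightarrow> real ^ 'n \<Rightarrow> real" where
  "gpow_x0 \<alpha> p r =
     - 1 / norm r +
     (gpow_psi \<alpha> * norm r
        + sqrt (gpow_chi \<alpha> p * (gpow_chi \<alpha> p / (norm r)\<^sup>2 + (gpow_psi \<alpha>)\<^sup>2 - 1)))
     / (gpow_chi \<alpha> p - (norm r)\<^sup>2)"

definition newton_iterate :: "(real \<Rightarrow> real) \<Rightarrow> real \<Rightarrow> nat \<Rightarrow> real" where
  "newton_iterate f x0 k = ((\<lambda>x. x - f x / deriv f x) ^^ k) x0"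

definition converges_quadratically :: "(nat \<Rightarrow> real) \<Rightarrow> real \<Rightarrow> bool" where
  "converges_quadratically X L \<longleftrightarrow>
     X \<longlonglongrightarrow> L \<and> (\<exists>C. \<forall>k. \<bar>X (Suc k) - L\<bar> \<le> C * \<bar>X k - L\<bar>\<^sup>2)"

end

theory Submission imports Defs begin

text \<open>
  Write \<open>\<rho> = \<parallel>r\<parallel>\<close>. The vector \<open>- g\<close> of the conjugate gradient \<open>g\<close> is the maximizer of
  \<open>F (u, w) = - p \<bullet> u - r \<bullet> w - f (u, w)\<close> for the dual barrier \<open>f\<close>. Setting the gradient of \<open>F\<close> to
  zero forces \<open>w = - (x / \<rho>) r\<close> and \<open>p\<^sub>i u\<^sub>i = 1 + \<alpha>\<^sub>i + \<alpha>\<^sub>i x \<rho>\<close> for some \<open>x > 0\<close>, and the last remaining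
  condition, that the weighted geometric mean \<open>P\<close> of the \<open>u\<^sub>i / \<alpha>\<^sub>i\<close> satisfies
  \<open>P\<^sup>2 = 2 x / \<rho> + x\<^sup>2\<close>, is \<open>h x = 0\<close> after taking logarithms.

  That such a point is the unique maximizer is shown without computing derivatives of \<open>F\<close>
  (lemma \<open>dual_objective_maximum\<close>). Each nonlinear term of \<open>F\<close> is bounded by its tangent at the
  critical point: \<open>- r \<bullet> w\<close> by the Cauchy-Schwarz inequality, \<open>P\<close> by the weighted inequality of arithmetic and
  geometric means, and the logarithms by \<open>ln t \<le> t - 1\<close>. The linear bounds add up to a constant
  exactly because the point is critical, and the equality cases of the inequalities leave no other
  maximizer.

  The scalar part rests on the identity
  \<open>h x = \<Sum>\<^sub>i 2 \<alpha>\<^sub>i ln (x + b\<^sub>i) - ln x - ln (x + c) + const\<close> with \<open>b\<^sub>i \<ge> c > 0\<close> and \<open>\<Sum>\<^sub>i \<alpha>\<^sub>i = 1\<close>, from which \<open>h\<close>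
  is strictly decreasing and convex on \<open>x > 0\<close>, with the negative limit \<open>ln (\<rho>\<^sup>2 / \<chi>)\<close> at infinity.
  For a function of this shape, the Newton iteration started to the left of the root increases towards it and converges
  quadratically (lemma \<open>newton_convex_decreasing\<close>). The point \<open>x\<^sub>0\<close> does lie to the left: by
  Jensen's inequality (lemma \<open>ln_plus_inverse_jensen\<close>), replacing every \<open>1 / \<alpha>\<^sub>i\<close> in \<open>h\<close> by
  \<open>\<psi>\<close> gives a lower bound of \<open>h\<close>, and the equation that this bound vanishes is quadratic with positive root \<open>x\<^sub>0\<close>.
  In particular \<open>h x\<^sub>0 \<ge> 0\<close>, which also serves as the left end of the intermediate value
  argument for the existence of the root.
\<close>

section \<open>Weighted geometric means\<close>

lemma prod_powr_eq_exp_sum_ln: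
  fixes a v :: "'i::finite \<Rightarrow> real"
  assumes "\<And>i. 0 < v i"
  shows "(\<Prod>i\<in>UNIV. v i powr a i) = exp (\<Sum>i\<in>UNIV. a i * ln (v i))"
proof -
  have "v i powr a i = exp (a i * ln (v i))" for i
    using assms[of i] by (simp add: powr_def)
  then show ?thesis by (simp add: exp_sum)
qed

lemma prod_powr_double:
  fixes a v :: "'i::finite \<Rightarrow> real"
  shows "(\<Prod>i\<in>UNIV. v i powr (2 * a i)) = (\<Prod>i\<in>UNIV. v i powr a i)\<^sup>2"
proof -
  have "v i powr (2 * a i) = v i powr a i * v i powr a i" for i
    by (metis mult_2 powr_add)
  then show ?thesis by (simp add: prod.distrib power2_eq_square)
qed

text \<open>
  Summing the nonnegative quantities \<open>a\<^sub>i (y\<^sub>i / T - 1 - ln (y\<^sub>i / T))\<close> gives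
  \<open>ln T - \<Sum>\<^sub>i a\<^sub>i ln y\<^sub>i\<close>. In the equality case every summand vanishes, which pins down each \<open>y\<^sub>i\<close>;
  the uniqueness of the maximizer depends on this.
\<close>

lemma weighted_AM_GM:
  fixes a y :: "'i::finite \<Rightarrow> real"
  assumes a: "\<And>i. 0 < a i" "(\<Sum>i\<in>UNIV. a i) = 1" and y: "\<And>i. 0 < y i"
  defines "T \<equiv> \<Sum>i\<in>UNIV. a i * y i"
  shows "(\<Prod>i\<in>UNIV. y i powr a i) \<le> T"
    and "(\<Prod>i\<in>UNIV. y i powr a i) = T \<Longrightarrow> y j = T"
proof -
  have T: "0 < T" unfolding T_def using a y by (intro sum_pos) auto
  have P: "(\<Prod>i\<in>UNIV. y i powr a i) = exp (\<Sum>i\<in>UNIV. a i * ln (y i))"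
    by (rule prod_powr_eq_exp_sum_ln[OF y])
  have nn: "0 \<le> a i * (y i / T - 1 - ln (y i / T))" for i
    using a(1)[of i] y[of i] T ln_le_minus_one[of "y i / T"] by simp
  have "(\<Sum>i\<in>UNIV. a i * (y i / T - 1 - ln (y i / T)))
      = (\<Sum>i\<in>UNIV. a i * y i / T - a i - a i * ln (y i) + a i * ln T)"
  proof (rule sum.cong[OF refl])
    fix i
    have "ln (y i / T) = ln (y i) - ln T" using y[of i] T by (simp add: ln_div)
    then show "a i * (y i / T - 1 - ln (y i / T)) = a i * y i / T - a i - a i * ln (y i) + a i * ln T"
      by (simp only:) (simp add: algebra_simps)
  qed
  also have "\<dots> = ln T - (\<Sum>i\<in>UNIV. a i * ln (y i))"
    using T a(2)
    by (simp add: sum.distrib sum_subtractf flip: sum_divide_distrib sum_distrib_right T_def)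
  finally have eq: "(\<Sum>i\<in>UNIV. a i * (y i / T - 1 - ln (y i / T)))
      = ln T - (\<Sum>i\<in>UNIV. a i * ln (y i))" .
  have "0 \<le> ln T - (\<Sum>i\<in>UNIV. a i * ln (y i))"
    unfolding eq[symmetric] by (rule sum_nonneg) (rule nn)
  then show "(\<Prod>i\<in>UNIV. y i powr a i) \<le> T"
    unfolding P using T by (metis diff_ge_0_iff_ge exp_le_cancel_iff exp_ln)
  assume "(\<Prod>i\<in>UNIV. y i powr a i) = T"
  then have "ln T = (\<Sum>i\<in>UNIV. a i * ln (y i))" unfolding P by (metis ln_exp)
  then have "(\<Sum>i\<in>UNIV. a i * (y i / T - 1 - ln (y i / T))) = 0" using eq by simp
  then have "a j * (y j / T - 1 - ln (y j / T)) = 0"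
    using nn by (subst (asm) sum_nonneg_eq_0_iff) auto
  then have "ln (y j / T) = y j / T - 1" using a(1)[of j] by simp
  then have "y j / T = 1" using y[of j] T by (intro ln_eq_minus_one) auto
  then show "y j = T" using T by simp
qed

section \<open>Interior of the cones\<close>

text \<open>
  The primal cone is the case \<open>c = 1\<close> and the dual cone the case \<open>c = a\<close>. An interior point stays in
  the cone when all \<open>u\<^sub>i\<close> are decreased by a small \<open>d > 0\<close>; since the product is strictly
  increasing, both defining inequalities are then strict at the point itself.
\<close>

lemma interior_powr_cone:
  fixes a c :: "real ^ 'm"
  assumes a: "\<And>i. 0 < a $ i" and c: "\<And>i. 0 < c $ i"
  shows "interior {(u, w :: real ^ 'n). (\<forall>i. 0 \<le> u $ i) \<and>
           norm w \<le> (\<Prod>i\<in>UNIV. (u $ i / c $ i) powr a $ i)}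
       = {(u, w). (\<forall>i. 0 < u $ i) \<and> norm w < (\<Prod>i\<in>UNIV. (u $ i / c $ i) powr a $ i)}"
    (is "interior ?K = ?I")
proof (rule antisym)
  let ?S = "{y :: (real ^ 'm) \<times> (real ^ 'n). \<forall>i. 0 < fst y $ i}"
  let ?f = "\<lambda>y :: (real ^ 'm) \<times> (real ^ 'n).
    (\<Prod>i\<in>UNIV. (fst y $ i / c $ i) powr a $ i) - norm (snd y)"
  have "open (\<Inter>i. {y :: (real ^ 'm) \<times> (real ^ 'n). 0 < fst y $ i})"
    by (intro open_INT ballI open_Collect_less continuous_intros) auto
  then have S: "open ?S" by (simp add: Collect_all_eq)
  have "continuous_on ?S ?f"
    using c by (intro continuous_intros) (auto simp: less_imp_neq[symmetric])
  from continuous_open_preimage[OF this S, of "{0<..}"]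
  have "open (?S \<inter> ?f -` {0<..})" by simp
  moreover have "?S \<inter> ?f -` {0<..} = ?I" by auto
  ultimately have "open ?I" by simp
  then show "?I \<subseteq> interior ?K"
    by (intro interior_maximal) (auto simp: less_imp_le)
  show "interior ?K \<subseteq> ?I"
  proof clarify
    fix u and w :: "real ^ 'n" assume "(u, w) \<in> interior ?K"
    then obtain e where e: "0 < e" "ball (u, w) e \<subseteq> ?K"
      by (auto simp: mem_interior)
    define d where "d = e / (2 * (norm (1 :: real ^ 'm) + 1))"
    have nz: "0 < norm (1 :: real ^ 'm) + 1" using norm_ge_zero[of "1 :: real ^ 'm"] by linarith
    have d: "0 < d" unfolding d_def using e(1) nz by simp
    have "d * norm (1 :: real ^ 'm) < d * (2 * (norm (1 :: real ^ 'm) + 1))"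
      using d norm_ge_zero[of "1 :: real ^ 'm"]
      by (intro mult_strict_left_mono) (auto simp del: norm_ge_zero)
    also have "\<dots> = e" unfolding d_def using nz by simp
    finally have "(u - d *\<^sub>R 1, w) \<in> ball (u, w) e"
      using d by (simp add: dist_Pair_Pair dist_norm)
    with e(2) have "(u - d *\<^sub>R 1, w) \<in> ?K" by blast
    then have nn: "\<And>i. 0 \<le> u $ i - d"
      and le: "norm w \<le> (\<Prod>i\<in>UNIV. ((u $ i - d) / c $ i) powr a $ i)" by auto
    have pos: "0 < u $ i" for i using nn[of i] d by simp
    have "(\<Prod>i\<in>UNIV. ((u $ i - d) / c $ i) powr a $ i)
        < (\<Prod>i\<in>UNIV. (u $ i / c $ i) powr a $ i)"
    proof (rule prod_mono_strict)
      fix i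
      show "0 \<le> ((u $ i - d) / c $ i) powr a $ i \<and>
        ((u $ i - d) / c $ i) powr a $ i \<le> (u $ i / c $ i) powr a $ i"
        using a[of i] c[of i] nn[of i] d
        by (auto intro!: powr_mono2 divide_right_mono)
      show "0 < (u $ i / c $ i) powr a $ i" using pos[of i] c[of i] by simp
    next
      show "((u $ undefined - d) / c $ undefined) powr a $ undefined
        < (u $ undefined / c $ undefined) powr a $ undefined"
        using a c nn d by (intro powr_less_mono2 divide_strict_right_mono divide_nonneg_pos) auto
    qed auto
    then show "(\<forall>i. 0 < u $ i) \<and> norm w < (\<Prod>i\<in>UNIV. (u $ i / c $ i) powr a $ i)"
      using pos le by auto
  qed
qed

lemma interior_gpow_cone:
  fixes \<alpha> :: "real ^ 'm"
  assumes "\<And>i. 0 < \<alpha> $ i"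
  shows "interior (gpow_cone \<alpha> :: ((real ^ 'm) \<times> (real ^ 'n)) set)
    = {(u, w). (\<forall>i. 0 < u $ i) \<and> norm w < (\<Prod>i\<in>UNIV. (u $ i) powr (\<alpha> $ i))}"
  using interior_powr_cone[of \<alpha> 1, where 'n='n] assms by (simp add: gpow_cone_def)

lemma interior_gpow_dual_cone:
  fixes \<alpha> :: "real ^ 'm"
  assumes "\<And>i. 0 < \<alpha> $ i"
  shows "interior (gpow_dual_cone \<alpha> :: ((real ^ 'm) \<times> (real ^ 'n)) set)
    = {(u, w). (\<forall>i. 0 < u $ i) \<and> norm w < (\<Prod>i\<in>UNIV. (u $ i / \<alpha> $ i) powr (\<alpha> $ i))}"
  using interior_powr_cone[of \<alpha> \<alpha>, where 'n='n] assms by (simp add: gpow_dual_cone_def)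

section \<open>The maximizer defining the conjugate gradient\<close>

lemma ln_le_tangent:
  fixes s t :: real
  assumes "0 < s" "0 < t"
  shows "ln s \<le> ln t + (s - t) / t" and "ln s = ln t + (s - t) / t \<Longrightarrow> s = t"
proof -
  have *: "ln (s / t) = ln s - ln t" "(s - t) / t = s / t - 1"
    using assms by (auto simp: ln_div diff_divide_distrib)
  show "ln s \<le> ln t + (s - t) / t" using ln_le_minus_one[of "s / t"] assms * by simp
  assume "ln s = ln t + (s - t) / t"
  then have "ln (s / t) = s / t - 1" using * by simp
  then have "s / t = 1" using assms by (intro ln_eq_minus_one) auto
  then show "s = t" using assms by simp
qed

text \<open>
  The function \<open>ln (P\<^sup>2 - v\<^sup>2) = ln (P + v) + ln (P - v)\<close> is concave and increasing in \<open>P\<close>, so it lies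
  below its tangent at \<open>(P0, v0)\<close> even when \<open>P\<close> is replaced by a larger \<open>Q\<close> in the tangent. Here
  \<open>Q\<close> will be a linear upper bound of a geometric mean.
\<close>

lemma ln_diff_squares_le_tangent:
  fixes P Q P0 v v0 :: real
  assumes "0 \<le> v" "v < P" "P \<le> Q" "0 \<le> v0" "v0 < P0"
  defines "B \<equiv> ln (P0\<^sup>2 - v0\<^sup>2) + (2 * P0 * (Q - P0) - 2 * v0 * (v - v0)) / (P0\<^sup>2 - v0\<^sup>2)"
  shows "ln (P\<^sup>2 - v\<^sup>2) \<le> B"
    and "ln (P\<^sup>2 - v\<^sup>2) = B \<Longrightarrow> P = P0 \<and> Q = P0 \<and> v = v0"
proof -
  have fac: "P\<^sup>2 - v\<^sup>2 = (P + v) * (P - v)" "P0\<^sup>2 - v0\<^sup>2 = (P0 + v0) * (P0 - v0)"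
    by (simp_all add: power2_eq_square algebra_simps)
  have pos: "0 < P + v" "0 < P - v" "0 < Q + v" "0 < Q - v" "0 < P0 + v0" "0 < P0 - v0"
    using assms by auto
  have lnP: "ln (P\<^sup>2 - v\<^sup>2) = ln (P + v) + ln (P - v)"
    unfolding fac using pos by (simp add: ln_mult)
  have B: "B = (ln (P0 + v0) + (Q + v - (P0 + v0)) / (P0 + v0))
             + (ln (P0 - v0) + (Q - v - (P0 - v0)) / (P0 - v0))"
  proof -
    have "(Q + v - (P0 + v0)) / (P0 + v0) + (Q - v - (P0 - v0)) / (P0 - v0)
        = (2 * P0 * (Q - P0) - 2 * v0 * (v - v0)) / ((P0 + v0) * (P0 - v0))"
      using pos by (simp add: add_frac_eq) (simp add: algebra_simps)
    moreover have "ln ((P0 + v0) * (P0 - v0)) = ln (P0 + v0) + ln (P0 - v0)"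
      using pos by (intro ln_mult_pos) auto
    ultimately show ?thesis unfolding B_def fac by simp
  qed
  note t = ln_le_tangent(1)[OF pos(3,5)] ln_le_tangent(1)[OF pos(4,6)]
  have m: "ln (P + v) \<le> ln (Q + v)" "ln (P - v) \<le> ln (Q - v)"
    using pos assms by auto
  show "ln (P\<^sup>2 - v\<^sup>2) \<le> B" unfolding lnP B using t m by linarith
  assume "ln (P\<^sup>2 - v\<^sup>2) = B"
  then have e: "ln (P + v) = ln (Q + v)"
    "ln (Q + v) = ln (P0 + v0) + (Q + v - (P0 + v0)) / (P0 + v0)"
    "ln (Q - v) = ln (P0 - v0) + (Q - v - (P0 - v0)) / (P0 - v0)"
    unfolding lnP B using t m by linarith+
  have "P + v = Q + v" using e(1) pos by (simp add: ln_inj_iff)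
  moreover have "Q + v = P0 + v0" by (rule ln_le_tangent(2)[OF pos(3,5) e(2)])
  moreover have "Q - v = P0 - v0" by (rule ln_le_tangent(2)[OF pos(4,6) e(3)])
  ultimately show "P = P0 \<and> Q = P0 \<and> v = v0" by auto
qed

text \<open>
  The hypotheses on \<open>(u0, w0)\<close> say that it is a critical point of \<open>F\<close> with \<open>\<parallel>w0\<parallel> = x\<close>. In the coordinates
  \<open>y\<^sub>i = u\<^sub>i / u0\<^sub>i\<close>, the difference \<open>F (u0, w0) - F (u, w)\<close> is a sum of three
  nonnegative gaps: one from the Cauchy-Schwarz inequality, one from the tangent of \<open>ln (P\<^sup>2 - \<parallel>w\<parallel>\<^sup>2)\<close>,
  and one from the tangents of the \<open>ln y\<^sub>i\<close>.
\<close>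

lemma dual_objective_maximum:
  fixes \<alpha> p u u0 :: "real ^ 'm" and r w w0 :: "real ^ 'n"
  assumes \<alpha>: "\<And>i. 0 < \<alpha> $ i" "(\<Sum>i\<in>UNIV. \<alpha> $ i) = 1"
    and p: "\<And>i. 0 < p $ i" and r: "r \<noteq> 0" and x: "0 < x"
    and u: "\<And>i. 0 < u $ i"
    and w: "norm w < (\<Prod>i\<in>UNIV. (u $ i / \<alpha> $ i) powr (\<alpha> $ i))"
    and u0: "\<And>i. p $ i * u0 $ i = (1 + \<alpha> $ i) + \<alpha> $ i * x * norm r"
    and w0: "w0 = - (x / norm r) *\<^sub>R r"
    and P0: "(\<Prod>i\<in>UNIV. (u0 $ i / \<alpha> $ i) powr (\<alpha> $ i))\<^sup>2 = 2 * x / norm r + x\<^sup>2"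
  defines "F \<equiv> \<lambda>y. - ((p, r) \<bullet> y) - gpow_dual_barrier \<alpha> y"
  shows "F (u, w) \<le> F (u0, w0)" and "F (u, w) = F (u0, w0) \<Longrightarrow> (u, w) = (u0, w0)"
proof -
  define \<rho> where "\<rho> = norm r"
  have \<rho>: "0 < \<rho>" using r by (simp add: \<rho>_def)
  have k: "0 < (1 + \<alpha> $ i) + \<alpha> $ i * x * \<rho>" for i
    using \<alpha>(1)[of i] x \<rho> by (simp add: add_pos_pos)
  have u0p: "0 < u0 $ i" for i
    using k[of i] u0[of i] p[of i] unfolding \<rho>_def by (metis zero_less_mult_pos)
  have \<alpha>1: "\<alpha> $ i \<le> 1" for i
    using member_le_sum[of i UNIV "\<lambda>i. \<alpha> $ i"] \<alpha> by (simp add: less_imp_le)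
  define y where "y = (\<lambda>i. u $ i / u0 $ i)"
  have y: "0 < y i" for i using u u0p by (simp add: y_def)
  have uy: "u $ i = u0 $ i * y i" for i using u0p[of i] by (simp add: y_def)
  define T where "T = (\<Sum>i\<in>UNIV. \<alpha> $ i * y i)"
  define P where "P = (\<Prod>i\<in>UNIV. (u $ i / \<alpha> $ i) powr (\<alpha> $ i))"
  define Q where "Q = (\<Prod>i\<in>UNIV. (u0 $ i / \<alpha> $ i) powr (\<alpha> $ i))"
  have Qpos: "0 < Q" unfolding Q_def using u0p \<alpha>
    by (intro prod_pos) (simp add: less_imp_neq[symmetric])
  have PQ: "P = Q * (\<Prod>i\<in>UNIV. y i powr (\<alpha> $ i))"
    unfolding P_def Q_def prod.distrib[symmetric]
  proof (rule prod.cong[OF refl])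
    fix i
    have "u $ i / \<alpha> $ i = (u0 $ i / \<alpha> $ i) * y i" using uy[of i] by simp
    then show "(u $ i / \<alpha> $ i) powr \<alpha> $ i = (u0 $ i / \<alpha> $ i) powr \<alpha> $ i * y i powr \<alpha> $ i"
      using u0p[of i] \<alpha>(1)[of i] y[of i] by (simp only: powr_mult)
  qed
  note am = weighted_AM_GM[of "\<lambda>i. \<alpha> $ i" y, OF \<alpha>(1) \<alpha>(2) y, folded T_def]
  have PT: "P \<le> Q * T" unfolding PQ using am(1) Qpos by simp
  have Q2: "Q\<^sup>2 = 2 * x / \<rho> + x\<^sup>2" using P0 by (simp add: Q_def \<rho>_def)
  then have D: "Q\<^sup>2 - x\<^sup>2 = 2 * x / \<rho>" by simp
  have "x\<^sup>2 < Q\<^sup>2" using Q2 x \<rho> by simp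
  then have xQ: "x < Q" using Qpos by (meson less_imp_le power_less_imp_less_base)
  have nw0: "norm w0 = x" unfolding w0 using x r by simp
  have rw0: "r \<bullet> w0 = - (x * \<rho>)"
    unfolding w0 \<rho>_def using r by (simp add: dot_square_norm power2_eq_square)
  have rw: "- (r \<bullet> w) \<le> \<rho> * norm w"
    using norm_cauchy_schwarz[of r "- w"] by (simp add: \<rho>_def)
  have wP: "norm w < P" using w by (simp add: P_def)
  define B where "B = ln (2 * x / \<rho>) + ((2 + \<rho> * x) * (T - 1) - \<rho> * (norm w - x))"
  have "(2 * Q * (Q * T - Q) - 2 * x * (norm w - x)) / (Q\<^sup>2 - x\<^sup>2)
      = (2 * Q\<^sup>2 * (T - 1) - 2 * x * (norm w - x)) / (2 * x / \<rho>)"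
    unfolding D by (simp add: power2_eq_square algebra_simps)
  also have "\<dots> = (2 + \<rho> * x) * (T - 1) - \<rho> * (norm w - x)"
    unfolding Q2 using x \<rho> by (simp add: field_simps power2_eq_square)
  finally have B_eq: "ln (Q\<^sup>2 - x\<^sup>2)
      + (2 * Q * (Q * T - Q) - 2 * x * (norm w - x)) / (Q\<^sup>2 - x\<^sup>2) = B"
    unfolding B_def D by simp
  note tan = ln_diff_squares_le_tangent[OF norm_ge_zero wP PT less_imp_le[OF x] xQ, unfolded B_eq]
  \<comment> \<open>For a single coordinate \<open>\<alpha> = 1\<close> and \<open>G\<close> is identically zero, so the equality case must come from
    the other two gaps.\<close>
  define G where "G = (\<Sum>i\<in>UNIV. (1 - \<alpha> $ i) * (y i - 1 - ln (y i)))"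
  have G: "0 \<le> G" unfolding G_def
    by (intro sum_nonneg mult_nonneg_nonneg) (use \<alpha>1 y ln_le_minus_one in \<open>auto simp: algebra_simps\<close>)
  have pu: "p \<bullet> u = (\<Sum>i\<in>UNIV. (1 - \<alpha> $ i) * y i) + (2 + \<rho> * x) * T"
  proof -
    have "p \<bullet> u = (\<Sum>i\<in>UNIV. (p $ i * u0 $ i) * y i)"
      by (simp add: inner_vec_def uy mult.assoc)
    also have "\<dots> = (\<Sum>i\<in>UNIV. (1 - \<alpha> $ i) * y i + (2 + \<rho> * x) * (\<alpha> $ i * y i))"
      unfolding u0 \<rho>_def by (rule sum.cong) (auto simp: algebra_simps)
    finally show ?thesis by (simp add: T_def sum.distrib sum_distrib_left)
  qed
  have pu0: "p \<bullet> u0 = (\<Sum>i\<in>UNIV. 1 - \<alpha> $ i) + (2 + \<rho> * x)"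
  proof -
    have "p \<bullet> u0 = (\<Sum>i\<in>UNIV. (1 - \<alpha> $ i) + (2 + \<rho> * x) * \<alpha> $ i)"
      unfolding inner_vec_def inner_real_def u0 \<rho>_def by (rule sum.cong) (auto simp: algebra_simps)
    then show ?thesis by (simp add: sum.distrib \<alpha>(2) flip: sum_distrib_left)
  qed
  have lnu: "(\<Sum>i\<in>UNIV. (1 - \<alpha> $ i) * ln (u $ i / \<alpha> $ i))
      = (\<Sum>i\<in>UNIV. (1 - \<alpha> $ i) * ln (u0 $ i / \<alpha> $ i))
        + (\<Sum>i\<in>UNIV. (1 - \<alpha> $ i) * y i) - (\<Sum>i\<in>UNIV. 1 - \<alpha> $ i) - G"
    unfolding G_def sum.distrib[symmetric] sum_subtractf[symmetric]
  proof (rule sum.cong[OF refl])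
    fix i
    have "ln (u $ i / \<alpha> $ i) = ln ((u0 $ i / \<alpha> $ i) * y i)" using uy[of i] by simp
    also have "\<dots> = ln (u0 $ i / \<alpha> $ i) + ln (y i)"
      using u0p[of i] \<alpha>(1)[of i] y[of i] by (intro ln_mult_pos) auto
    finally show "(1 - \<alpha> $ i) * ln (u $ i / \<alpha> $ i) = (1 - \<alpha> $ i) * ln (u0 $ i / \<alpha> $ i)
        + (1 - \<alpha> $ i) * y i - (1 - \<alpha> $ i) - (1 - \<alpha> $ i) * (y i - 1 - ln (y i))"
      by (simp add: algebra_simps)
  qed
  have gap: "F (u0, w0) - F (u, w)
      = (\<rho> * norm w + r \<bullet> w) + (B - ln (P\<^sup>2 - (norm w)\<^sup>2)) + G"
    unfolding F_def gpow_dual_barrier_def prod.case prod_powr_double inner_Pair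
      P_def[symmetric] Q_def[symmetric] lnu pu pu0 rw0 nw0 D B_def
    by (simp add: algebra_simps)
  show "F (u, w) \<le> F (u0, w0)" using gap rw tan(1) G by linarith
  assume "F (u, w) = F (u0, w0)"
  then have e: "ln (P\<^sup>2 - (norm w)\<^sup>2) = B" "- (r \<bullet> w) = \<rho> * norm w"
    using gap rw tan(1) G by linarith+
  \<comment> \<open>The tangent gap determines \<open>\<parallel>w\<parallel>\<close> and forces equality between the two means; with mean
    \<open>T = 1\<close> all \<open>y\<^sub>i\<close> are then \<open>1\<close>. The direction of \<open>w\<close> comes from the Cauchy-Schwarz gap.\<close>
  from tan(2)[OF e(1)] have E: "P = Q" "Q * T = Q" "norm w = x" by auto
  then have T1: "T = 1" using Qpos by simp
  have "(\<Prod>i\<in>UNIV. y i powr (\<alpha> $ i)) = T" using PQ E(1) Qpos T1 by simp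
  then have "y i = 1" for i using am(2)[of i] T1 by simp
  then have "u = u0" using uy by (simp add: vec_eq_iff)
  moreover have "norm r *\<^sub>R (- w) = norm (- w) *\<^sub>R r"
    using e(2) norm_cauchy_schwarz_eq[of r "- w"] by (simp add: \<rho>_def)
  then have "norm r *\<^sub>R w = norm r *\<^sub>R w0" unfolding w0 using E(3) r
    by (simp add: neg_eq_iff_add_eq_0 eq_neg_iff_add_eq_0)
  then have "w = w0" using r by simp
  ultimately show "(u, w) = (u0, w0)" by simp
qed

section \<open>Newton iteration on a decreasing convex function\<close>

text \<open>
  The mean value theorem on \<open>[x, L]\<close> gives some \<open>\<xi>\<close> for which the error of a Newton step from \<open>x\<close> is
  \<open>(L - x) (1 - f' \<xi> / f' x)\<close>. As \<open>f'\<close> is negative and increasing, the factor is between \<open>0\<close> and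
  \<open>1 - f' L / f' a < 1\<close>, whence the iteration stays in \<open>[a, L]\<close> and converges; as \<open>f'\<close> is
  Lipschitz, the factor is also at most a multiple of \<open>L - x\<close>, whence the rate is quadratic.
\<close>

lemma newton_convex_decreasing:
  fixes f f' f'' :: "real \<Rightarrow> real"
  assumes aL: "a \<le> L"
    and f: "\<And>x. x \<in> {a..L} \<Longrightarrow> (f has_real_derivative f' x) (at x)"
    and f': "\<And>x. x \<in> {a..L} \<Longrightarrow> (f' has_real_derivative f'' x) (at x)"
    and f'': "\<And>x. x \<in> {a..L} \<Longrightarrow> 0 \<le> f'' x \<and> f'' x \<le> M"
    and root: "f L = 0" and neg: "f' L < 0"
  shows "newton_iterate f a k \<in> {a..L}"
    and "converges_quadratically (newton_iterate f a) L"
proof -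
  define N where "N = (\<lambda>x. x - f x / deriv f x)"
  have X_Suc: "newton_iterate f a (Suc k) = N (newton_iterate f a k)" for k
    by (simp add: newton_iterate_def N_def)
  have f'_incr: "f' x \<le> f' z" "f' z - f' x \<le> M * (z - x)" if "a \<le> x" "x \<le> z" "z \<le> L" for x z
  proof -
    have "\<exists>\<xi>. a \<le> \<xi> \<and> \<xi> \<le> L \<and> f' z - f' x = (z - x) * f'' \<xi>"
    proof (cases "x = z")
      case True then show ?thesis using that by (intro exI[of _ x]) auto
    next
      case False
      then have "\<exists>\<xi>. x < \<xi> \<and> \<xi> < z \<and> f' z - f' x = (z - x) * f'' \<xi>"
        using that by (intro MVT2 f') auto
      then show ?thesis using that by (meson less_imp_le order_trans)
    qed
    then obtain \<xi> where "a \<le> \<xi>" "\<xi> \<le> L" and eq: "f' z - f' x = (z - x) * f'' \<xi>" by blast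
    then have "0 \<le> f'' \<xi>" "f'' \<xi> \<le> M" using f''[of \<xi>] by auto
    then have "0 \<le> (z - x) * f'' \<xi>" "(z - x) * f'' \<xi> \<le> (z - x) * M"
      using that by (auto intro: mult_left_mono)
    then show "f' x \<le> f' z" "f' z - f' x \<le> M * (z - x)"
      using eq by (auto simp: mult.commute)
  qed
  have f'_neg: "f' x < 0" if "a \<le> x" "x \<le> L" for x
    using f'_incr(1)[OF that order_refl] neg by simp
  define q where "q = 1 - f' L / f' a"
  define C where "C = M / - f' L"
  have step: "N x \<in> {x..L} \<and> L - N x \<le> q * (L - x) \<and> L - N x \<le> C * (L - x)\<^sup>2"
    if x: "x \<in> {a..L}" for x
  proof (cases "x = L")
    case True then show ?thesis using root by (simp add: N_def)
  next
    case False
    then have "\<exists>\<xi>. x < \<xi> \<and> \<xi> < L \<and> f L - f x = (L - x) * f' \<xi>"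
      using x by (intro MVT2 f) auto
    then obtain \<xi> where \<xi>: "x < \<xi>" "\<xi> < L" "f L - f x = (L - x) * f' \<xi>" by blast
    have n: "f' x < 0" "f' \<xi> < 0" "f' a < 0" using x \<xi> aL by (auto intro!: f'_neg)
    have le: "f' a \<le> f' x" "f' x \<le> f' \<xi>" "f' \<xi> \<le> f' L" "f' x \<le> f' L"
      using x \<xi> by (auto intro!: f'_incr(1))
    have "deriv f x = f' x" using f[OF x] by (rule DERIV_imp_deriv)
    then have Nx: "N x = x + (L - x) * (f' \<xi> / f' x)"
      using \<xi>(3) root by (simp add: N_def algebra_simps minus_divide_left[symmetric])
    then have err: "L - N x = (L - x) * (1 - f' \<xi> / f' x)" by (simp add: algebra_simps)
    have ratio: "0 \<le> f' \<xi> / f' x" "f' \<xi> / f' x \<le> 1"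
      using n le by (auto simp: divide_nonpos_neg divide_le_eq)
    have "0 \<le> (L - x) * (f' \<xi> / f' x)" using ratio(1) x by (intro mult_nonneg_nonneg) auto
    then have lo: "x \<le> N x" unfolding Nx by simp
    have "0 \<le> L - N x" unfolding err using ratio(2) x by simp
    then have hi: "N x \<le> L" by simp
    have "f' L / f' a = - f' L / - f' a" by simp
    also have "\<dots> \<le> - f' \<xi> / - f' x"
      using n le neg by (intro frac_le) auto
    finally have "f' L / f' a \<le> f' \<xi> / f' x" by simp
    then have lin: "L - N x \<le> q * (L - x)"
      unfolding err q_def using x by (subst mult.commute) (intro mult_right_mono, auto)
    have "1 - f' \<xi> / f' x = (f' \<xi> - f' x) / - f' x" using n by (simp add: field_simps)
    also have "\<dots> \<le> M * (L - x) / - f' L"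
    proof (rule frac_le)
      have "f' \<xi> - f' x \<le> f' L - f' x" using le by simp
      also have "\<dots> \<le> M * (L - x)" using x by (intro f'_incr(2)) auto
      finally show "f' \<xi> - f' x \<le> M * (L - x)" .
      then show "0 \<le> M * (L - x)" using le by linarith
    qed (use neg le in auto)
    finally have "(L - x) * (1 - f' \<xi> / f' x) \<le> (L - x) * (M * (L - x) / - f' L)"
      using x by (intro mult_left_mono) auto
    also have "\<dots> = C * (L - x)\<^sup>2" by (simp add: C_def power2_eq_square)
    finally show ?thesis using lo hi lin err by simp
  qed
  have inI: "newton_iterate f a k \<in> {a..L}" for k
  proof (induction k)
    case 0 then show ?case using aL by (simp add: newton_iterate_def)
  next
    case (Suc k) then show ?case using step[OF Suc] by (simp add: X_Suc)
  qed
  then show "newton_iterate f a k \<in> {a..L}" .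
  have q: "0 \<le> q" "q < 1"
    using f'_neg[OF order_refl aL] f'_incr(1)[OF order_refl aL order_refl] neg
    by (auto simp: q_def divide_le_eq zero_less_divide_iff)
  have geo: "\<bar>newton_iterate f a k - L\<bar> \<le> q ^ k * (L - a)" for k
  proof (induction k)
    case 0 then show ?case using aL by (simp add: newton_iterate_def)
  next
    case (Suc k)
    have "L - newton_iterate f a (Suc k) \<le> q * (L - newton_iterate f a k)"
      using step[OF inI[of k]] by (simp add: X_Suc)
    also have "\<dots> \<le> q * (q ^ k * (L - a))"
      using Suc inI[of k] q by (intro mult_left_mono) auto
    finally show ?case using inI[of "Suc k"] by simp
  qed
  have "(\<lambda>k. q ^ k * (L - a)) \<longlonglongrightarrow> 0"
    using q by (intro tendsto_mult_left_zero LIMSEQ_realpow_zero)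
  then have "(\<lambda>k. newton_iterate f a k - L) \<longlonglongrightarrow> 0"
    by (rule Lim_null_comparison[rotated]) (use geo in auto)
  then have lim: "newton_iterate f a \<longlonglongrightarrow> L" by (simp add: LIM_zero_iff)
  have "\<bar>newton_iterate f a (Suc k) - L\<bar> \<le> C * \<bar>newton_iterate f a k - L\<bar>\<^sup>2" for k
    using step[OF inI[of k]] by (simp add: X_Suc power2_commute)
  then show "converges_quadratically (newton_iterate f a) L"
    unfolding converges_quadratically_def using lim by blast
qed

section \<open>A Jensen inequality for the starting point\<close>

text \<open>
  Jensen's inequality for the convex function \<open>\<lambda>y. ln (s + 1 / y)\<close> and the weights \<open>a\<close>, evaluated at
  the points \<open>a i\<close> themselves. Their mean is the sum of the squares, which is how the constant
  \<open>\<psi>\<close> enters the starting point of the iteration.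
\<close>

lemma ln_plus_inverse_jensen:
  fixes a :: "'i::finite \<Rightarrow> real"
  assumes a: "\<And>i. 0 < a i" "(\<Sum>i\<in>UNIV. a i) = 1" and s: "0 < s"
  shows "ln (s + 1 / (\<Sum>i\<in>UNIV. (a i)\<^sup>2)) \<le> (\<Sum>i\<in>UNIV. a i * ln (s + 1 / a i))"
proof -
  define m where "m = (\<Sum>i\<in>UNIV. (a i)\<^sup>2)"
  have m: "0 < m" unfolding m_def by (intro sum_pos zero_less_power a(1)) auto
  define d where "d = 1 / (m * (s * m + 1))"
  \<comment> \<open>The coefficient \<open>-d\<close> is the derivative of \<open>\<lambda>y. ln (s + 1 / y)\<close> at \<open>m\<close>. The weighted mean of the
    \<open>a i\<close>, each weighted by itself, is \<open>m\<close>, so the linear terms cancel in the sum.\<close>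
  have tangent: "ln (s + 1 / m) + d * (m - y) \<le> ln (s + 1 / y)" if y: "0 < y" for y
  proof -
    have pos: "0 < s + 1 / m" "0 < s + 1 / y" "0 < s * y + 1" "0 < s * m + 1"
      using s m y by (auto intro: add_pos_pos)
    have "s + 1 / m - (s + 1 / y) = (y - m) / (m * y)" "s + 1 / y = (s * y + 1) / y"
      using m y by (simp_all add: field_simps)
    then have "(s + 1 / m - (s + 1 / y)) / (s + 1 / y) = (y - m) / (m * (s * y + 1))"
      using y by simp
    then have "ln (s + 1 / m) \<le> ln (s + 1 / y) - (m - y) / (m * (s * y + 1))"
      using ln_le_tangent(1)[OF pos(1,2)] by (simp add: diff_divide_distrib)
    moreover have "(m - y) / (m * (s * y + 1)) - d * (m - y)
        = s * (m - y)\<^sup>2 / (m * (s * y + 1) * (s * m + 1))"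
    proof -
      have "(m - y) / (m * (s * y + 1)) - d * (m - y)
          = ((m - y) * (s * m + 1) - (m - y) * (s * y + 1)) / (m * (s * y + 1) * (s * m + 1))"
        unfolding d_def using m pos by (simp add: diff_divide_distrib)
      then show ?thesis by (simp add: power2_eq_square algebra_simps)
    qed
    moreover have "0 \<le> s * (m - y)\<^sup>2 / (m * (s * y + 1) * (s * m + 1))"
      using s m pos by simp
    ultimately show ?thesis by linarith
  qed
  have "ln (s + 1 / m) = (\<Sum>i\<in>UNIV. (ln (s + 1 / m) + d * m) * a i - d * (a i)\<^sup>2)"
    by (simp add: sum_subtractf a(2) flip: sum_distrib_left m_def)
  also have "\<dots> = (\<Sum>i\<in>UNIV. a i * (ln (s + 1 / m) + d * (m - a i)))"
    by (simp add: algebra_simps power2_eq_square)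
  also have "\<dots> \<le> (\<Sum>i\<in>UNIV. a i * ln (s + 1 / a i))"
    using a(1) by (intro sum_mono mult_left_mono tangent) (auto intro: less_imp_le)
  finally show ?thesis unfolding m_def .
qed

section \<open>Shape of the scalar equation\<close>

text \<open>The last two assumptions are the membership of \<open>(p, r)\<close> in the interior of the primal cone.\<close>

locale gpow_instance =
  fixes \<alpha> p :: "real ^ 'm" and r :: "real ^ 'n"
  assumes \<alpha>_pos: "\<And>i. 0 < \<alpha> $ i"
    and \<alpha>_sum: "(\<Sum>i\<in>UNIV. \<alpha> $ i) = 1"
    and r_nonzero: "r \<noteq> 0"
    and p_pos: "\<And>i. 0 < p $ i"
    and r_less: "norm r < (\<Prod>i\<in>UNIV. (p $ i) powr (\<alpha> $ i))"
begin

abbreviation "h \<equiv> gpow_h \<alpha> p r"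

text \<open>
  The numbers \<open>0\<close>, \<open>- c\<close> and \<open>- b i\<close> are the poles of the derivative of \<open>h\<close>. All sign conditions on the derivatives
  below reduce to \<open>0 < c \<le> b i\<close>.
\<close>

definition c where "c = 2 / norm r"

definition b where "b i = (1 + \<alpha> $ i) / (\<alpha> $ i * norm r)"

definition h' where "h' x = (\<Sum>i\<in>UNIV. 2 * \<alpha> $ i / (x + b i)) - 1 / x - 1 / (x + c)"

definition h'' where
  "h'' x = 1 / x\<^sup>2 + 1 / (x + c)\<^sup>2 - (\<Sum>i\<in>UNIV. 2 * \<alpha> $ i / (x + b i)\<^sup>2)"

lemma norm_r_pos: "0 < norm r" using r_nonzero by simp

lemma \<alpha>_le_1: "\<alpha> $ i \<le> 1"
  using member_le_sum[of i UNIV "\<lambda>i. \<alpha> $ i"] \<alpha>_pos \<alpha>_sum by (simp add: less_imp_le)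

lemma c_pos: "0 < c" using norm_r_pos by (simp add: c_def)

lemma c_le_b: "c \<le> b i"
  using \<alpha>_le_1[of i] \<alpha>_pos[of i] norm_r_pos by (simp add: c_def b_def field_simps)

lemma ln_chi: "ln (gpow_chi \<alpha> p) = (\<Sum>i\<in>UNIV. 2 * \<alpha> $ i * ln (p $ i))"
  by (simp add: gpow_chi_def prod_powr_eq_exp_sum_ln[OF p_pos])

lemma norm_r_sq_less_chi: "(norm r)\<^sup>2 < gpow_chi \<alpha> p"
  unfolding gpow_chi_def prod_powr_double using r_less by (intro power_strict_mono) auto

lemma chi_pos: "0 < gpow_chi \<alpha> p"
  using norm_r_sq_less_chi by (meson le_less_trans zero_le_power2)

lemma h_eq:
  assumes x: "0 < x"
  shows "h x = (\<Sum>i\<in>UNIV. 2 * \<alpha> $ i * ln (x + b i)) - ln x - ln (x + c)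
    + (ln ((norm r)\<^sup>2) - ln (gpow_chi \<alpha> p))"
proof -
  have "(\<Sum>i\<in>UNIV. 2 * \<alpha> $ i * ln (norm r * x + (1 + \<alpha> $ i) / \<alpha> $ i))
      = (\<Sum>i\<in>UNIV. 2 * \<alpha> $ i * ln (x + b i) + 2 * ln (norm r) * \<alpha> $ i)"
  proof (rule sum.cong[OF refl])
    fix i
    have "norm r * x + (1 + \<alpha> $ i) / \<alpha> $ i = norm r * (x + b i)"
      using norm_r_pos \<alpha>_pos[of i] by (simp add: b_def field_simps)
    moreover have "0 < x + b i" using x c_pos c_le_b[of i] by linarith
    ultimately have "ln (norm r * x + (1 + \<alpha> $ i) / \<alpha> $ i) = ln (norm r) + ln (x + b i)"
      using norm_r_pos by (simp add: ln_mult_pos)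
    then show "2 * \<alpha> $ i * ln (norm r * x + (1 + \<alpha> $ i) / \<alpha> $ i)
        = 2 * \<alpha> $ i * ln (x + b i) + 2 * ln (norm r) * \<alpha> $ i"
      by (simp add: algebra_simps)
  qed
  also have "\<dots> = (\<Sum>i\<in>UNIV. 2 * \<alpha> $ i * ln (x + b i)) + ln ((norm r)\<^sup>2)"
    using norm_r_pos by (simp add: sum.distrib \<alpha>_sum ln_realpow flip: sum_distrib_left)
  finally have 1: "(\<Sum>i\<in>UNIV. 2 * \<alpha> $ i * ln (norm r * x + (1 + \<alpha> $ i) / \<alpha> $ i)) = \<dots>" .
  have "2 * x / norm r + x\<^sup>2 = x * (x + c)" by (simp add: c_def power2_eq_square algebra_simps)
  then have 2: "ln (2 * x / norm r + x\<^sup>2) = ln x + ln (x + c)"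
    using x c_pos by (simp add: ln_mult_pos)
  show ?thesis unfolding gpow_h_def ln_chi[symmetric] 1 2 by simp
qed

lemma x_plus_b_pos: "0 < x \<Longrightarrow> 0 < x + b i"
  using c_pos c_le_b[of i] by linarith

lemma DERIV_h:
  assumes x: "0 < x"
  shows "(h has_real_derivative h' x) (at x)"
proof -
  have "((\<lambda>x. (\<Sum>i\<in>UNIV. 2 * \<alpha> $ i * ln (x + b i)) - ln x - ln (x + c)
      + (ln ((norm r)\<^sup>2) - ln (gpow_chi \<alpha> p))) has_real_derivative h' x) (at x)"
    using x c_pos x_plus_b_pos[OF x] unfolding h'_def
    by (auto intro!: derivative_eq_intros simp: less_imp_neq[symmetric])
  then show ?thesis
    by (rule has_field_derivative_transform_within_open[where S = "{0<..}"])
      (use x in \<open>auto simp: h_eq\<close>)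
qed

lemma DERIV_h':
  assumes x: "0 < x"
  shows "(h' has_real_derivative h'' x) (at x)"
proof -
  have inv: "((\<lambda>x. k / (x + d)) has_real_derivative - (k / (x + d)\<^sup>2)) (at x)"
    if "0 < x + d" for k d
    using that by (auto intro!: derivative_eq_intros simp: power2_eq_square)
  have "((\<lambda>x. (\<Sum>i\<in>UNIV. 2 * \<alpha> $ i / (x + b i)) - 1 / (x + 0) - 1 / (x + c)) has_real_derivative
      (\<Sum>i\<in>UNIV. - (2 * \<alpha> $ i / (x + b i)\<^sup>2)) - - (1 / (x + 0)\<^sup>2) - - (1 / (x + c)\<^sup>2)) (at x)"
    using x c_pos x_plus_b_pos[OF x] by (intro DERIV_diff DERIV_sum inv) auto
  then show ?thesis
    unfolding h'_def[abs_def] h''_def by (simp add: sum_negf algebra_simps)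
qed

text \<open>
  Both sign conditions replace every \<open>b i\<close> by \<open>c\<close>: the weighted sum, of total weight \<open>2\<close>, is then
  absorbed by the terms with poles at \<open>- c\<close> and, closer to \<open>x\<close>, at \<open>0\<close>.
\<close>

lemma h'_neg:
  assumes x: "0 < x"
  shows "h' x < 0"
proof -
  have "(\<Sum>i\<in>UNIV. 2 * \<alpha> $ i / (x + b i)) \<le> (\<Sum>i\<in>UNIV. 2 / (x + c) * \<alpha> $ i)"
  proof (rule sum_mono)
    fix i
    have "2 * \<alpha> $ i / (x + b i) \<le> 2 * \<alpha> $ i / (x + c)"
      using \<alpha>_pos[of i] c_le_b[of i] c_pos x by (intro frac_le) auto
    then show "2 * \<alpha> $ i / (x + b i) \<le> 2 / (x + c) * \<alpha> $ i" by simp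
  qed
  also have "\<dots> = 2 / (x + c)" by (subst sum_distrib_left[symmetric]) (simp add: \<alpha>_sum)
  moreover have "1 / (x + c) < 1 / x" using x c_pos by (intro divide_strict_left_mono) auto
  ultimately show ?thesis unfolding h'_def by simp
qed

lemma h''_nonneg:
  assumes x: "0 < x"
  shows "0 \<le> h'' x"
proof -
  have "(\<Sum>i\<in>UNIV. 2 * \<alpha> $ i / (x + b i)\<^sup>2) \<le> (\<Sum>i\<in>UNIV. 2 / (x + c)\<^sup>2 * \<alpha> $ i)"
  proof (rule sum_mono)
    fix i
    have "2 * \<alpha> $ i / (x + b i)\<^sup>2 \<le> 2 * \<alpha> $ i / (x + c)\<^sup>2"
      using \<alpha>_pos[of i] c_le_b[of i] c_pos x by (intro frac_le power_mono) auto
    then show "2 * \<alpha> $ i / (x + b i)\<^sup>2 \<le> 2 / (x + c)\<^sup>2 * \<alpha> $ i" by simp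
  qed
  also have "\<dots> = 2 / (x + c)\<^sup>2" by (subst sum_distrib_left[symmetric]) (simp add: \<alpha>_sum)
  moreover have "1 / (x + c)\<^sup>2 \<le> 1 / x\<^sup>2" using x c_pos by (intro frac_le power_mono) auto
  ultimately show ?thesis unfolding h''_def by simp
qed

lemma h''_bounded:
  assumes "0 < a" "a \<le> x"
  shows "h'' x \<le> 2 / a\<^sup>2"
proof -
  have "0 \<le> (\<Sum>i\<in>UNIV. 2 * \<alpha> $ i / (x + b i)\<^sup>2)"
    by (intro sum_nonneg) (simp add: \<alpha>_pos less_imp_le)
  moreover have "1 / x\<^sup>2 \<le> 1 / a\<^sup>2" "1 / (x + c)\<^sup>2 \<le> 1 / a\<^sup>2"
    using assms c_pos by (intro frac_le power_mono; auto)+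
  ultimately show ?thesis unfolding h''_def by simp
qed

lemma h_strict_decreasing:
  assumes "0 < x" "x < y"
  shows "h y < h x"
proof (rule DERIV_neg_imp_decreasing[OF assms(2)])
  fix t assume "x \<le> t" "t \<le> y"
  then show "\<exists>d. (h has_real_derivative d) (at t) \<and> d < 0"
    using assms DERIV_h[of t] h'_neg[of t] by auto
qed

text \<open>
  At infinity the logarithms cancel and \<open>h\<close> approaches \<open>- K\<close>; the bound \<open>ln (y + b i) \<le> ln y + b i / y\<close>
  makes this explicit.
\<close>

lemma h_eventually_neg: "\<exists>y>x. h y < 0"
proof -
  define K where "K = ln (gpow_chi \<alpha> p) - ln ((norm r)\<^sup>2)"
  have K: "0 < K" unfolding K_def using norm_r_sq_less_chi chi_pos norm_r_pos by simp
  define S where "S = (\<Sum>i\<in>UNIV. 2 * \<alpha> $ i * b i)"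
  define y where "y = \<bar>x\<bar> + \<bar>S\<bar> / K + 1"
  have y: "x < y" "0 < y" "S < K * y"
  proof -
    have 0: "0 \<le> \<bar>S\<bar> / K" using K by simp
    then show "x < y" "0 < y" unfolding y_def by linarith+
    have "S \<le> K * (\<bar>S\<bar> / K)" using K by simp
    also have "\<dots> < K * y" using K 0 unfolding y_def by (intro mult_strict_left_mono) linarith+
    finally show "S < K * y" .
  qed
  have "(\<Sum>i\<in>UNIV. 2 * \<alpha> $ i * ln (y + b i)) \<le> (\<Sum>i\<in>UNIV. 2 * ln y * \<alpha> $ i + 2 * \<alpha> $ i * b i / y)"
  proof (rule sum_mono)
    fix i
    have "ln (y + b i) \<le> ln y + b i / y"
      using ln_le_tangent(1)[OF x_plus_b_pos[OF y(2)] y(2), of i] by simp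
    then have "2 * \<alpha> $ i * ln (y + b i) \<le> 2 * \<alpha> $ i * (ln y + b i / y)"
      using \<alpha>_pos[of i] by (intro mult_left_mono) auto
    then show "2 * \<alpha> $ i * ln (y + b i) \<le> 2 * ln y * \<alpha> $ i + 2 * \<alpha> $ i * b i / y"
      by (simp add: algebra_simps)
  qed
  also have "\<dots> = 2 * ln y + S / y"
    by (simp add: sum.distrib \<alpha>_sum S_def sum_divide_distrib flip: sum_distrib_left)
  moreover have "S / y < K" using y by (simp add: divide_less_eq)
  moreover have "ln y \<le> ln (y + c)" using y c_pos by simp
  ultimately have "h y < 0" unfolding h_eq[OF y(2)] K_def by linarith
  then show ?thesis using y(1) by blast
qed

section \<open>The starting point\<close>

text \<open>
  With \<open>s = \<rho> x + 1\<close> and \<open>C = \<chi> / \<rho>\<^sup>2 > 1\<close>, the Jensen lower bound of \<open>h\<close> vanishes iff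
  \<open>(s + \<psi>)\<^sup>2 = C (s\<^sup>2 - 1)\<close>. The point \<open>x\<^sub>0\<close> corresponds to the positive root of this quadratic equation, and
  the equation itself forces \<open>s > 1\<close>, that is \<open>x\<^sub>0 > 0\<close>.
\<close>

lemma x0_pos_and_h_nonneg:
  shows x0_pos: "0 < gpow_x0 \<alpha> p r" and h_x0_nonneg: "0 \<le> h (gpow_x0 \<alpha> p r)"
proof -
  define \<rho> where "\<rho> = norm r"
  define \<psi> where "\<psi> = gpow_psi \<alpha>"
  define C where "C = gpow_chi \<alpha> p / \<rho>\<^sup>2"
  define x where "x = gpow_x0 \<alpha> p r"
  define s where "s = \<rho> * x + 1"
  have \<rho>: "0 < \<rho>" using norm_r_pos by (simp add: \<rho>_def)
  have \<psi>: "0 < \<psi>" unfolding \<psi>_def gpow_psi_def by (intro divide_pos_pos sum_pos zero_less_power \<alpha>_pos) auto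
  have chi: "gpow_chi \<alpha> p = C * \<rho>\<^sup>2" using \<rho> by (simp add: C_def)
  have C: "1 < C" using norm_r_sq_less_chi \<rho> by (simp add: C_def \<rho>_def)
  define R where "R = sqrt (C * (C + \<psi>\<^sup>2 - 1))"
  have R2: "R\<^sup>2 = C * (C + \<psi>\<^sup>2 - 1)" 
    unfolding R_def using C zero_le_power2[of \<psi>]
    by (intro real_sqrt_pow2 mult_nonneg_nonneg) linarith+
  have R: "0 \<le> R"
    unfolding R_def using C zero_le_power2[of \<psi>]
    by (intro real_sqrt_ge_zero mult_nonneg_nonneg) linarith+
  have "sqrt (gpow_chi \<alpha> p * (gpow_chi \<alpha> p / \<rho>\<^sup>2 + \<psi>\<^sup>2 - 1)) = sqrt (\<rho>\<^sup>2 * (C * (C + \<psi>\<^sup>2 - 1)))"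
    unfolding chi using \<rho> by (simp add: algebra_simps)
  also have "\<dots> = \<rho> * R" using \<rho> by (simp add: real_sqrt_mult R_def)
  finally have "x = - 1 / \<rho> + (\<psi> * \<rho> + \<rho> * R) / (C * \<rho>\<^sup>2 - \<rho>\<^sup>2)"
    unfolding x_def gpow_x0_def \<rho>_def[symmetric] \<psi>_def[symmetric] by (simp add: chi)
  moreover have "\<rho> * ((\<psi> * \<rho> + \<rho> * R) / (C * \<rho>\<^sup>2 - \<rho>\<^sup>2)) = (\<psi> + R) / (C - 1)"
  proof -
    have "C * \<rho>\<^sup>2 - \<rho>\<^sup>2 = \<rho>\<^sup>2 * (C - 1)" by (simp add: algebra_simps)
    then show ?thesis using \<rho> C by (simp add: divide_simps) (simp add: power2_eq_square algebra_simps)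
  qed
  ultimately have s_eq: "s = (\<psi> + R) / (C - 1)"
    unfolding s_def using \<rho> by (simp only: distrib_left) simp
  then have sC: "(C - 1) * s - \<psi> = R" using C by (simp add: field_simps)
  have s0: "0 < s" unfolding s_eq using C R \<psi> by simp
  have "(C - 1) * ((s + \<psi>)\<^sup>2 - C * (s\<^sup>2 - 1)) = R\<^sup>2 - ((C - 1) * s - \<psi>)\<^sup>2"
    unfolding R2 by (simp add: power2_eq_square algebra_simps)
  then have quad: "(s + \<psi>)\<^sup>2 = C * (s\<^sup>2 - 1)" unfolding sC using C by simp
  have "0 < (s + \<psi>)\<^sup>2" using s0 \<psi> by simp
  then have "0 < s\<^sup>2 - 1" unfolding quad using C by (simp add: zero_less_mult_iff)
  then have "1\<^sup>2 < s\<^sup>2" by simp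
  then have "1 < s" using s0 by (meson less_imp_le power_less_imp_less_base)
  then have xpos: "0 < x" unfolding s_def using \<rho> by (simp add: zero_less_mult_iff)
  have e: "2 * x / \<rho> + x\<^sup>2 = (s\<^sup>2 - 1) / \<rho>\<^sup>2"
    unfolding s_def using \<rho> by (simp add: field_simps power2_eq_square)
  have epos: "0 < 2 * x / \<rho> + x\<^sup>2" using xpos \<rho> by (simp add: add_pos_pos)
  have "gpow_chi \<alpha> p * (2 * x / \<rho> + x\<^sup>2) = (s + \<psi>)\<^sup>2"
    unfolding chi e quad using \<rho> by simp
  then have "ln (gpow_chi \<alpha> p) + ln (2 * x / \<rho> + x\<^sup>2) = ln ((s + \<psi>)\<^sup>2)"
    using ln_mult_pos[OF chi_pos epos] by simp
  also have "\<dots> = 2 * ln (s + \<psi>)" using s0 \<psi> by (simp add: ln_realpow)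
  also have "\<dots> \<le> 2 * (\<Sum>i\<in>UNIV. \<alpha> $ i * ln (s + 1 / \<alpha> $ i))"
    using ln_plus_inverse_jensen[OF \<alpha>_pos \<alpha>_sum s0] by (simp add: \<psi>_def gpow_psi_def)
  also have "\<dots> = (\<Sum>i\<in>UNIV. 2 * \<alpha> $ i * ln (\<rho> * x + (1 + \<alpha> $ i) / \<alpha> $ i))"
    unfolding sum_distrib_left
  proof (rule sum.cong[OF refl])
    fix i
    have "s + 1 / \<alpha> $ i = \<rho> * x + (1 + \<alpha> $ i) / \<alpha> $ i"
      using \<alpha>_pos[of i] by (simp add: s_def add_divide_distrib)
    then show "2 * (\<alpha> $ i * ln (s + 1 / \<alpha> $ i))
        = 2 * \<alpha> $ i * ln (\<rho> * x + (1 + \<alpha> $ i) / \<alpha> $ i)" by simp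
  qed
  finally have "0 \<le> h x"
    unfolding gpow_h_def ln_chi[symmetric] \<rho>_def[symmetric] by simp
  then show "0 < gpow_x0 \<alpha> p r" "0 \<le> h (gpow_x0 \<alpha> p r)" using xpos by (simp_all add: x_def)
qed

lemma ex1_root: "\<exists>!x. 0 < x \<and> h x = 0"
proof (rule ex_ex1I)
  let ?a = "gpow_x0 \<alpha> p r"
  obtain y where y: "?a < y" "h y < 0" using h_eventually_neg by blast
  have "\<exists>x\<ge>?a. x \<le> y \<and> h x = 0"
  proof (rule IVT2)
    show "\<forall>x. ?a \<le> x \<and> x \<le> y \<longrightarrow> isCont h x"
      using x0_pos by (auto intro!: DERIV_isCont[OF DERIV_h])
  qed (use y h_x0_nonneg in auto)
  then show "\<exists>x. 0 < x \<and> h x = 0" using x0_pos by (meson less_le_trans)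
next
  fix x y assume "0 < x \<and> h x = 0" "0 < y \<and> h y = 0"
  then show "x = y" using h_strict_decreasing[of x y] h_strict_decreasing[of y x]
    by (cases x y rule: linorder_cases) auto
qed

text \<open>
  Since \<open>h\<close> decreases and \<open>h x\<^sub>0 \<ge> 0\<close>, the starting point is to the left of the root; its
  positivity keeps the second derivative bounded on the interval between them.
\<close>

lemma newton_at_root:
  assumes x: "0 < x" "h x = 0"
  shows "0 < newton_iterate h (gpow_x0 \<alpha> p r) k"
    and "converges_quadratically (newton_iterate h (gpow_x0 \<alpha> p r)) x"
proof -
  let ?a = "gpow_x0 \<alpha> p r"
  have ax: "?a \<le> x"
  proof (rule ccontr)
    assume "\<not> ?a \<le> x"
    then have "h ?a < h x" using x by (intro h_strict_decreasing) auto
    then show False using h_x0_nonneg x by simp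
  qed
  have D: "(h has_real_derivative h' t) (at t)" "(h' has_real_derivative h'' t) (at t)"
    "0 \<le> h'' t \<and> h'' t \<le> 2 / ?a\<^sup>2" if "t \<in> {?a..x}" for t
    using that x0_pos DERIV_h[of t] DERIV_h'[of t] h''_nonneg[of t] h''_bounded[of ?a t] by auto
  note N = newton_convex_decreasing[where f = h and f' = h' and f'' = h'' and M = "2 / ?a\<^sup>2",
    OF ax D x(2) h'_neg[OF x(1)]]
  from N(1)[of k] x0_pos show "0 < newton_iterate h ?a k" by auto
  from N(2) show "converges_quadratically (newton_iterate h ?a) x" .
qed

section \<open>The conjugate gradient\<close>

text \<open>
  The equation \<open>h x = 0\<close> is the logarithm of the condition on the geometric mean at \<open>(u0, w0)\<close>, and it
  also places \<open>(u0, w0)\<close> in the interior of the dual cone, because \<open>P\<^sup>2 - x\<^sup>2 = 2 x / \<parallel>r\<parallel> > 0\<close>.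
\<close>

lemma conj_gradient_at_root:
  assumes x: "0 < x" "h x = 0"
  shows "is_conj_gradient (gpow_dual_barrier \<alpha>) (gpow_dual_cone \<alpha>) (p, r) g \<longleftrightarrow>
    g = ((\<chi> i. - ((1 + \<alpha> $ i) + \<alpha> $ i * x * norm r) / p $ i), (x / norm r) *\<^sub>R r)"
proof -
  define u0 where "u0 = (\<chi> i. ((1 + \<alpha> $ i) + \<alpha> $ i * x * norm r) / p $ i)"
  define w0 where "w0 = - (x / norm r) *\<^sub>R r"
  define P where "P = (\<Prod>i\<in>UNIV. (u0 $ i / \<alpha> $ i) powr (\<alpha> $ i))"
  have neg: "- (u0, w0) = ((\<chi> i. - ((1 + \<alpha> $ i) + \<alpha> $ i * x * norm r) / p $ i), (x / norm r) *\<^sub>R r)"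
  proof -
    have "- u0 = (\<chi> i. - ((1 + \<alpha> $ i) + \<alpha> $ i * x * norm r) / p $ i)"
      unfolding vec_eq_iff u0_def by (simp only: vector_uminus_component vec_lambda_beta minus_divide_left) simp
    moreover have "- w0 = (x / norm r) *\<^sub>R r" unfolding w0_def by simp
    ultimately show ?thesis by (simp only: uminus_Pair)
  qed
  have pu0: "p $ i * u0 $ i = (1 + \<alpha> $ i) + \<alpha> $ i * x * norm r" for i
    using p_pos[of i] by (simp add: u0_def)
  have u0_pos: "0 < u0 $ i" for i
    unfolding u0_def using p_pos[of i] \<alpha>_pos[of i] x(1) norm_r_pos
    by (simp add: add_pos_pos)
  have va_pos: "0 < u0 $ i / \<alpha> $ i" for i using u0_pos[of i] \<alpha>_pos[of i] by simp
  have P: "P = exp (\<Sum>i\<in>UNIV. \<alpha> $ i * ln (u0 $ i / \<alpha> $ i))"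
    unfolding P_def by (rule prod_powr_eq_exp_sum_ln[OF va_pos])
  have P_pos: "0 < P" unfolding P by simp
  have dpos: "0 < 2 * x / norm r + x\<^sup>2" using x norm_r_pos by (simp add: add_pos_pos)
  have "ln (P\<^sup>2) = 2 * (\<Sum>i\<in>UNIV. \<alpha> $ i * ln (u0 $ i / \<alpha> $ i))"
    unfolding P by (simp add: ln_realpow)
  also have "\<dots> = (\<Sum>i\<in>UNIV. 2 * \<alpha> $ i * ln (norm r * x + (1 + \<alpha> $ i) / \<alpha> $ i)
      - 2 * \<alpha> $ i * ln (p $ i))"
    unfolding sum_distrib_left
  proof (rule sum.cong[OF refl])
    fix i
    have "u0 $ i / \<alpha> $ i = (norm r * x + (1 + \<alpha> $ i) / \<alpha> $ i) / p $ i"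
      using \<alpha>_pos[of i] p_pos[of i] by (simp add: u0_def field_simps)
    moreover have "0 < norm r * x + (1 + \<alpha> $ i) / \<alpha> $ i"
      using \<alpha>_pos[of i] x(1) norm_r_pos by (simp add: add_pos_pos)
    ultimately have "ln (u0 $ i / \<alpha> $ i) = ln (norm r * x + (1 + \<alpha> $ i) / \<alpha> $ i) - ln (p $ i)"
      using p_pos[of i] by (simp add: ln_div)
    then show "2 * (\<alpha> $ i * ln (u0 $ i / \<alpha> $ i))
      = 2 * \<alpha> $ i * ln (norm r * x + (1 + \<alpha> $ i) / \<alpha> $ i) - 2 * \<alpha> $ i * ln (p $ i)"
      by (simp only: right_diff_distrib mult.assoc)
  qed
  also have "\<dots> = ln (2 * x / norm r + x\<^sup>2)"
    using x(2) unfolding gpow_h_def sum_subtractf by linarith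
  finally have "ln (P\<^sup>2) = ln (2 * x / norm r + x\<^sup>2)" .
  then have P2: "P\<^sup>2 = 2 * x / norm r + x\<^sup>2"
    by (rule ln_inj_iff[THEN iffD1, rotated 2]) (simp_all only: P_pos dpos zero_less_power)
  have "x\<^sup>2 < P\<^sup>2" unfolding P2 using x norm_r_pos by simp
  then have "x < P" by (rule power_less_imp_less_base) (simp only: P_pos less_imp_le)
  then have nw0: "norm w0 < P" using x r_nonzero by (simp add: w0_def)
  define F where "F = (\<lambda>y. - ((p, r) \<bullet> y) - gpow_dual_barrier \<alpha> y)"
  define I where "I = interior (gpow_dual_cone \<alpha> :: ((real ^ 'm) \<times> (real ^ 'n)) set)"
  note I_eq = interior_gpow_dual_cone[OF \<alpha>_pos, where 'n='n, folded I_def]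
  have in0: "(u0, w0) \<in> I" unfolding I_eq using u0_pos nw0 by (simp add: P_def)
  have max: "F y \<le> F (u0, w0)" "F y = F (u0, w0) \<Longrightarrow> y = (u0, w0)" if "y \<in> I" for y
  proof -
    obtain u w where y: "y = (u, w)" by (cases y)
    then have uw: "\<And>i. 0 < u $ i" "norm w < (\<Prod>i\<in>UNIV. (u $ i / \<alpha> $ i) powr (\<alpha> $ i))"
      using that by (auto simp: I_eq)
    note M = dual_objective_maximum[OF \<alpha>_pos \<alpha>_sum p_pos r_nonzero x(1) uw pu0 w0_def
        P2[unfolded P_def]]
    show "F y \<le> F (u0, w0)" unfolding y F_def by (rule M(1))
    show "y = (u0, w0)" if "F y = F (u0, w0)" using that unfolding y F_def by (rule M(2))
  qed
  have "is_arg_max F (\<lambda>y. y \<in> I) z \<longleftrightarrow> z = (u0, w0)" for z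
  proof
    assume z: "is_arg_max F (\<lambda>y. y \<in> I) z"
    then have "z \<in> I" "\<not> F z < F (u0, w0)" using in0 by (auto simp: is_arg_max_def)
    then show "z = (u0, w0)" using max[of z] by simp
  next
    assume "z = (u0, w0)"
    then show "is_arg_max F (\<lambda>y. y \<in> I) z"
      unfolding is_arg_max_def using in0 max(1) by (simp add: not_less)
  qed
  then have "is_conj_gradient (gpow_dual_barrier \<alpha>) (gpow_dual_cone \<alpha>) (p, r) g
      \<longleftrightarrow> - g = (u0, w0)"
    unfolding is_conj_gradient_def F_def[symmetric] I_def by blast
  also have "\<dots> \<longleftrightarrow> g = - (u0, w0)" by (metis minus_minus)
  finally show ?thesis unfolding neg .
qed

end

theorem theorem5:
  fixes \<alpha> p :: "real ^ 'm" and r :: "real ^ 'n"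
  assumes "\<forall>i. 0 < \<alpha> $ i"
    and "(\<Sum>i\<in>UNIV. \<alpha> $ i) = 1"
    and "r \<noteq> 0"
    and "(p, r) \<in> interior (gpow_cone \<alpha>)"
  shows "(\<exists>!x. 0 < x \<and> gpow_h \<alpha> p r x = 0) \<and>
    (\<forall>x. 0 < x \<and> gpow_h \<alpha> p r x = 0 \<longrightarrow>
      (\<forall>g. is_conj_gradient (gpow_dual_barrier \<alpha>) (gpow_dual_cone \<alpha>) (p, r) g \<longleftrightarrow>
         g = ((\<chi> i. - ((1 + \<alpha> $ i) + \<alpha> $ i * x * norm r) / p $ i),
              (x / norm r) *\<^sub>R r)) \<and>
      (\<forall>k. 0 < newton_iterate (gpow_h \<alpha> p r) (gpow_x0 \<alpha> p r) k \<and>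
         gpow_h \<alpha> p r differentiable at (newton_iterate (gpow_h \<alpha> p r) (gpow_x0 \<alpha> p r) k) \<and>
         deriv (gpow_h \<alpha> p r) (newton_iterate (gpow_h \<alpha> p r) (gpow_x0 \<alpha> p r) k) \<noteq> 0) \<and>
      converges_quadratically (newton_iterate (gpow_h \<alpha> p r) (gpow_x0 \<alpha> p r)) x)"
proof -
  have "\<And>i. 0 < p $ i" "norm r < (\<Prod>i\<in>UNIV. (p $ i) powr (\<alpha> $ i))"
    using assms(1,4) by (auto simp: interior_gpow_cone)
  then interpret gpow_instance \<alpha> p r
    using assms by unfold_locales auto
  have diff: "h differentiable at t" "deriv h t \<noteq> 0" if "0 < t" for t
    using DERIV_h[OF that] h'_neg[OF that]
    by (auto simp: DERIV_imp_deriv real_differentiable_def)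
  show ?thesis
    using ex1_root conj_gradient_at_root newton_at_root diff by blast
qed

end
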